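(* If $G$ is a finitely generated group possessing a subgroup $H$ of index $2$ which has unsolvable conjugacy problem, then $G$ has an overgroup $K$, with $|K:G|=3$, such that $K$ has unsolvable conjugacy problem.
   Context: An overgroup of $G$ is a group containing $G$ as a subgroup. For a group $A$ generated by a finite set $Z$, the conjugacy problem in $A$ is solvable if there is an algorithm which, given two words over $Z^{\pm1}$, decides whether or not the elements of $A$ they represent are conjugate in $A$; otherwise it is unsolvable. *)

theory Defs
  imports "HOL-Algebra.Algebra" "HOL-Library.Nat_Bijection"
begin

section \<open>Algorithms: the partial recursive functions\<close>

datatype recf = Zero | Succ | Proj nat | Comp recf "recf list" | Rec recf recf | Mu recf

text \<open>
  \<open>computes p xs y\<close>: the program \<open>p\<close> halts on the argument list \<open>xs\<close> with output \<open>y\<close> (Kleene's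
  schemata). Arities are not tracked; on argument lists of unsuitable length a program merely
  diverges or ignores arguments. In \<open>Mu\<close> all values before the first zero must be defined.
\<close>

inductive computes :: "recf \<Rightarrow> nat list \<Rightarrow> nat \<Rightarrow> bool" where
  Zero: "computes Zero xs 0"
| Succ: "computes Succ [x] (Suc x)"
| Proj: "i < length xs \<Longrightarrow> computes (Proj i) xs (xs ! i)"
| Comp: "\<lbrakk>length ys = length gs; \<forall>i<length gs. computes (gs ! i) xs (ys ! i); computes f ys z\<rbrakk>
    \<Longrightarrow> computes (Comp f gs) xs z"
| Rec_0: "computes f xs y \<Longrightarrow> computes (Rec f g) (0 # xs) y"
| Rec_Suc: "\<lbrakk>computes (Rec f g) (n # xs) r; computes g (n # r # xs) y\<rbrakk>
    \<Longrightarrow> computes (Rec f g) (Suc n # xs) y"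
| Mu: "\<lbrakk>computes f (n # xs) 0; \<forall>m<n. \<exists>y. computes f (m # xs) (Suc y)\<rbrakk>
    \<Longrightarrow> computes (Mu f) xs n"

lemma computes_deterministic:
  "computes p xs y \<Longrightarrow> computes p xs y' \<Longrightarrow> y = y'"
proof (induction arbitrary: y' rule: computes.induct)
  case (Comp ys gs xs f z)
  from Comp.prems show ?case
  proof cases
    case (Comp ys')
    with Comp.IH have "ys = ys'"
      using \<open>length ys = length gs\<close> by (auto intro!: nth_equalityI)
    with Comp.IH Comp show ?thesis by blast
  qed
next
  case (Rec_Suc f g n xs r y)
  from Rec_Suc.prems show ?case
    by cases (use Rec_Suc.IH in blast)
next
  case (Mu f n xs)
  from Mu.prems show ?case
  proof cases
    case Mu': Mu
    show ?thesis
    proof (rule linorder_cases [of n y'])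
      assume "n < y'"
      then obtain y where "computes f (n # xs) (Suc y)" using Mu' by blast
      with Mu.IH(1) show ?thesis by fastforce
    next
      assume "y' < n"
      with Mu.IH(2) Mu' show ?thesis by fastforce
    qed
  qed
qed (erule computes.cases; simp)+


section \<open>The conjugacy problem\<close>

definition generating_set :: "('a, 'b) monoid_scheme \<Rightarrow> 'a set \<Rightarrow> bool" where
  "generating_set A Z \<longleftrightarrow> Z \<subseteq> carrier A \<and> generate A Z = carrier A"

definition finitely_generated :: "('a, 'b) monoid_scheme \<Rightarrow> bool" where
  "finitely_generated A \<longleftrightarrow> (\<exists>Z. finite Z \<and> generating_set A Z)"

text \<open>The letter \<open>(z, True)\<close> stands for \<open>z\<close> and \<open>(z, False)\<close> for its inverse.\<close>

definition group_words :: "'a set \<Rightarrow> ('a \<times> bool) list set" where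
  "group_words Z = lists (Z \<times> UNIV)"

fun word_eval :: "('a, 'b) monoid_scheme \<Rightarrow> ('a \<times> bool) list \<Rightarrow> 'a" where
  "word_eval A [] = \<one>\<^bsub>A\<^esub>"
| "word_eval A ((z, e) # w) = (if e then z else inv\<^bsub>A\<^esub> z) \<otimes>\<^bsub>A\<^esub> word_eval A w"

definition conjugate_in :: "('a, 'b) monoid_scheme \<Rightarrow> 'a \<Rightarrow> 'a \<Rightarrow> bool" where
  "conjugate_in A x y \<longleftrightarrow> (\<exists>g\<in>carrier A. y = g \<otimes>\<^bsub>A\<^esub> x \<otimes>\<^bsub>A\<^esub> inv\<^bsub>A\<^esub> g)"

text \<open>Words are presented to an algorithm through a numbering \<open>c\<close> of the generators.\<close>

definition word_code :: "('a \<Rightarrow> nat) \<Rightarrow> ('a \<times> bool) list \<Rightarrow> nat" where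
  "word_code c w = list_encode (map (\<lambda>(z, e). 2 * c z + of_bool e) w)"

text \<open>
  Intended for finite generating sets \<open>Z\<close>. The alphabet being finite, changing the numbering \<open>c\<close>
  only permutes finitely many letters, so solvability does not depend on it.
\<close>

definition conjugacy_problem_solvable :: "('a, 'b) monoid_scheme \<Rightarrow> 'a set \<Rightarrow> bool" where
  "conjugacy_problem_solvable A Z \<longleftrightarrow>
    (\<exists>c p. bij_betw c Z {..<card Z} \<and>
      (\<forall>u\<in>group_words Z. \<forall>v\<in>group_words Z.
        computes p [word_code c u, word_code c v]
          (if conjugate_in A (word_eval A u) (word_eval A v) then 1 else 0)))"

end

theory Submission
  imports Defs
begin

text \<open>
  Let \<open>C = \<langle>c\<rangle>\<close> be cyclic of order 3 and let \<open>K\<close> be the semidirect product of \<open>C\<close> with \<open>G\<close>, where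
  \<open>G\<close> acts on \<open>C\<close> through \<open>G/H\<close> by inversion. For \<open>h, h' \<in> H\<close>, comparing the
  \<open>C\<close>-components shows that an element of \<open>K\<close> conjugating \<open>h c\<close> to \<open>h' c\<close> has its \<open>G\<close>-component in \<open>H\<close>; hence
  \<open>h c\<close> and \<open>h' c\<close> are conjugate in \<open>K\<close> iff \<open>h\<close> and \<open>h'\<close> are conjugate in \<open>H\<close>. Rewriting a
  word for \<open>h\<close> into a word for \<open>h\<^sup>-\<^sup>1 c\<close> is computable, so an algorithm for \<open>K\<close> yields one for \<open>H\<close>.
\<close>

section \<open>Programs\<close>

lemma computes_Proj: "i < length xs \<Longrightarrow> y = xs ! i \<Longrightarrow> computes (Proj i) xs y"
  by (simp add: computes.Proj)

lemma computes_Comp1: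
  assumes "computes g xs y" "computes f [y] z"
  shows "computes (Comp f [g]) xs z"
  by (rule computes.Comp [where ys = "[y]"]) (use assms in auto)

lemma computes_Comp2:
  assumes "computes g xs y" "computes g' xs y'" "computes f [y, y'] z"
  shows "computes (Comp f [g, g']) xs z"
  by (rule computes.Comp [where ys = "[y, y']"]) (use assms in \<open>auto simp: less_Suc_eq\<close>)

text \<open>\<open>F\<close> gives the intermediate values for fixed parameters \<open>xs\<close>;
  it is the loop invariant in later uses of recursion.\<close>

lemma computes_Rec:
  assumes "computes f xs (F 0)" "\<And>m. computes g (m # F m # xs) (F (Suc m))"
  shows "computes (Rec f g) (n # xs) (F n)"
  by (induction n) (use assms in \<open>auto intro: computes.intros\<close>)

definition recf_pred :: recf where
  "recf_pred = Rec Zero (Proj 0)"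

lemma computes_pred: "computes recf_pred [n] (n - 1)"
  unfolding recf_pred_def
  by (rule computes_Rec [where F = "\<lambda>n. n - 1"]) (auto intro: computes.Zero computes_Proj)

definition recf_add :: recf where
  "recf_add = Rec (Proj 0) (Comp Succ [Proj 1])"

lemma computes_add: "computes recf_add [m, n] (m + n)"
  unfolding recf_add_def
  by (rule computes_Rec [where F = "\<lambda>m. m + n"])
    (auto intro!: computes_Comp1 [OF computes_Proj] computes.Succ intro: computes_Proj)

text \<open>The arguments are swapped because recursion is on the first one.\<close>

definition recf_minus :: recf where
  "recf_minus = Rec (Proj 0) (Comp recf_pred [Proj 1])"

lemma computes_minus: "computes recf_minus [m, n] (n - m)"
  unfolding recf_minus_def
proof (rule computes_Rec [where F = "\<lambda>m. n - m"])
  show "computes (Comp recf_pred [Proj 1]) [m, n - m, n] (n - Suc m)" for m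
    using computes_pred [of "n - m"] by (auto intro!: computes_Comp1 [OF computes_Proj])
qed (auto intro: computes_Proj)

definition recf_triangle :: recf where
  "recf_triangle = Rec Zero (Comp recf_add [Proj 1, Comp Succ [Proj 0]])"

lemma computes_triangle: "computes recf_triangle [n] (triangle n)"
  unfolding recf_triangle_def
proof (rule computes_Rec)
  show "computes (Comp recf_add [Proj 1, Comp Succ [Proj 0]]) [m, triangle m] (triangle (Suc m))" for m
    using computes_add [of "triangle m" "Suc m"]
    by (auto intro!: computes_Comp2 [OF computes_Proj computes_Comp1 [OF computes_Proj computes.Succ]])
qed (auto intro: computes.Zero)

section \<open>Prepending fixed entries to list codes\<close>

fun recf_const :: "nat \<Rightarrow> recf" where
  "recf_const 0 = Zero"
| "recf_const (Suc n) = Comp Succ [recf_const n]"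

lemma computes_const: "computes (recf_const n) xs n"
  by (induction n) (auto intro: computes.Zero computes.Succ computes_Comp1)

text \<open>Applied to \<open>n = list_encode l\<close>, this is the successor of the Cantor pairing
  \<open>triangle (x + n) + x\<close>, with the head \<open>x\<close> built in as a
  constant.\<close>

definition recf_cons :: "nat \<Rightarrow> recf" where
  "recf_cons x =
    Comp Succ [Comp recf_add [Comp recf_triangle [Comp recf_add [recf_const x, Proj 0]], recf_const x]]"

lemma computes_cons: "computes (recf_cons x) [list_encode l] (list_encode (x # l))"
  unfolding recf_cons_def
  by (auto simp: prod_encode_def intro!: computes_Comp1 [OF _ computes.Succ]
      computes_Comp2 [OF _ _ computes_add] computes_Comp1 [OF _ computes_triangle]
      computes_const computes_Proj)

lemma computes_append: "\<exists>q. \<forall>l. computes q [list_encode l] (list_encode (ws @ l))"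
proof (induction ws)
  case Nil
  show ?case by (rule exI [of _ "Proj 0"]) (auto intro: computes_Proj)
next
  case (Cons w ws)
  then obtain q where "\<And>l. computes q [list_encode l] (list_encode (ws @ l))" by blast
  then show ?case
    by (intro exI [of _ "Comp (recf_cons w) [q]"]) (auto simp del: list_encode.simps
        intro!: computes_Comp1 [OF _ computes_cons])
qed

section \<open>Inverting the Cantor pairing\<close>

definition recf_diagonal :: recf where
  "recf_diagonal =
    Mu (Comp recf_minus [Comp recf_triangle [Comp Succ [Proj 0]], Comp Succ [Proj 1]])"

lemma triangle_mono: "m \<le> n \<Longrightarrow> triangle m \<le> triangle n"
  by (induction rule: dec_induct) simp_all

text \<open>Writing \<open>n = triangle s + a\<close> with \<open>a \<le> s\<close>, \<open>s\<close> is least with \<open>n < triangle (s + 1)\<close>.\<close>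

lemma computes_diagonal: "computes recf_diagonal [prod_encode (a, b)] (a + b)"
proof -
  let ?n = "prod_encode (a, b)"
  let ?f = "Comp recf_minus [Comp recf_triangle [Comp Succ [Proj 0]], Comp Succ [Proj 1]]"
  \<comment> \<open>Truncated subtraction vanishes exactly when
    \<open>?n < triangle (Suc m)\<close>; the \<open>Suc\<close> before \<open>?n\<close> makes the
    inequality strict.\<close>
  have f: "computes ?f [m, ?n] (Suc ?n - triangle (Suc m))" for m
    by (auto intro!: computes_Comp2 [OF _ _ computes_minus] computes_Comp1 [OF _ computes_triangle]
        computes_Comp1 [OF _ computes.Succ] computes_Proj simp del: triangle_Suc)
  have 0: "Suc ?n - triangle (Suc (a + b)) = 0"
    by (simp add: prod_encode_def)
  have pos: "\<exists>y. Suc ?n - triangle (Suc m) = Suc y" if "m < a + b" for m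
  proof -
    have "triangle (Suc m) \<le> triangle (a + b)"
      using that by (intro triangle_mono) simp
    then have "triangle (Suc m) \<le> ?n"
      by (simp add: prod_encode_def del: triangle_Suc)
    then show ?thesis by (simp add: Suc_diff_le del: triangle_Suc)
  qed
  show ?thesis
    unfolding recf_diagonal_def
    by (rule computes.Mu) (use f 0 pos in metis)+
qed

text \<open>Subtracting \<open>triangle (a + b)\<close> from the code
  \<open>triangle (a + b) + a\<close> leaves \<open>a\<close>.\<close>

definition recf_fst :: recf where
  "recf_fst = Comp recf_minus [Comp recf_triangle [recf_diagonal], Proj 0]"

lemma computes_fst: "computes recf_fst [prod_encode (a, b)] a"
proof -
  have "computes recf_fst [prod_encode (a, b)] (prod_encode (a, b) - triangle (a + b))"
    unfolding recf_fst_def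
    by (auto intro!: computes_Comp2 [OF _ _ computes_minus] computes_Comp1 [OF _ computes_triangle]
        computes_diagonal computes_Proj)
  then show ?thesis by (simp add: prod_encode_def)
qed

definition recf_snd :: recf where
  "recf_snd = Comp recf_minus [recf_fst, recf_diagonal]"

lemma computes_snd: "computes recf_snd [prod_encode (a, b)] b"
proof -
  have "computes recf_snd [prod_encode (a, b)] (a + b - a)"
    unfolding recf_snd_def
    by (intro computes_Comp2 [OF _ _ computes_minus] computes_fst computes_diagonal)
  then show ?thesis by simp
qed

lemma computes_fst': "computes recf_fst [n] (fst (prod_decode n))"
  by (metis computes_fst prod.collapse prod_decode_inverse)

lemma computes_snd': "computes recf_snd [n] (snd (prod_decode n))"
  by (metis computes_snd prod.collapse prod_decode_inverse)

section \<open>Traversing a list code\<close>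

definition recf_tl :: recf where
  "recf_tl = Rec Zero (Comp recf_snd [Proj 0])"

lemma computes_tl: "computes recf_tl [list_encode l] (list_encode (tl l))"
proof -
  \<comment> \<open>Recursion is only a case split here: the step ignores the recursive value and
    reads the counter \<open>m\<close>, which for a nonempty list is the pair of head and coded
    tail.\<close>
  have "computes recf_tl [n] (case n of 0 \<Rightarrow> 0 | Suc m \<Rightarrow> snd (prod_decode m))" for n
    unfolding recf_tl_def
    by (rule computes_Rec)
      (auto intro!: computes.Zero computes_Comp1 [OF _ computes_snd'] computes_Proj)
  from this [of "list_encode l"] show ?thesis by (cases l) simp_all
qed

definition recf_drop :: recf where
  "recf_drop = Rec (Proj 0) (Comp recf_tl [Proj 1])"

lemma computes_drop: "computes recf_drop [n, list_encode l] (list_encode (drop n l))"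
  unfolding recf_drop_def
proof (rule computes_Rec [where F = "\<lambda>n. list_encode (drop n l)"])
  show "computes (Comp recf_tl [Proj 1]) [m, list_encode (drop m l), list_encode l]
    (list_encode (drop (Suc m) l))" for m
    using computes_tl [of "drop m l"]
    by (auto simp: drop_Suc tl_drop intro!: computes_Comp1 [OF computes_Proj])
qed (auto intro: computes_Proj)

text \<open>Lets the code of a list itself serve as a sufficient number of iterations.\<close>

lemma length_le_list_encode: "length l \<le> list_encode l"
proof (induction l)
  case (Cons x l)
  then show ?case using le_prod_encode_2 [of "list_encode l" x] by simp
qed simp

text \<open>After \<open>n\<close> rounds the state is \<open>fold h (take n l) r0\<close>; the next
  round reads the head of \<open>drop n l\<close>. Running \<open>list_encode l\<close> rounds
  exhausts the list.\<close>

lemma computes_fold: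
  assumes step: "\<And>x r. computes s [x, r] (h x r)"
  shows "\<exists>q. \<forall>l. computes q [list_encode l] (fold h l r0)"
proof -
  let ?s = "Rec (Proj 0) (Comp s [Comp recf_fst [Proj 0], Proj 2])"
  have s: "computes ?s [n, r] (case n of 0 \<Rightarrow> r | Suc m \<Rightarrow> h (fst (prod_decode m)) r)" for n r
    by (rule computes_Rec) (auto intro!: computes_Comp2 [OF _ _ step]
        computes_Comp1 [OF _ computes_fst'] computes_Proj)
  let ?g = "Rec (recf_const r0) (Comp ?s [Comp recf_drop [Proj 0, Proj 2], Proj 1])"
  have g: "computes ?g [n, list_encode l] (fold h (take n l) r0)" for n l
  proof (rule computes_Rec [where F = "\<lambda>n. fold h (take n l) r0"])
    fix m
    have "computes (Comp ?s [Comp recf_drop [Proj 0, Proj 2], Proj 1])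
      [m, fold h (take m l) r0, list_encode l]
      (case list_encode (drop m l) of 0 \<Rightarrow> fold h (take m l) r0
        | Suc k \<Rightarrow> h (fst (prod_decode k)) (fold h (take m l) r0))"
      by (auto intro!: computes_Comp2 [OF _ _ s] computes_Comp2 [OF _ _ computes_drop] computes_Proj)
    moreover have "(case list_encode (drop m l) of 0 \<Rightarrow> fold h (take m l) r0
        | Suc k \<Rightarrow> h (fst (prod_decode k)) (fold h (take m l) r0)) = fold h (take (Suc m) l) r0"
    \<comment> \<open>Past the end, \<open>drop m l\<close> has code 0, so surplus rounds leave the
      state unchanged.\<close>
    proof (cases "m < length l")
      case True
      then show ?thesis
        by (simp add: Cons_nth_drop_Suc [symmetric] take_Suc_conv_app_nth)
    qed simp
    ultimately show "computes (Comp ?s [Comp recf_drop [Proj 0, Proj 2], Proj 1])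
      [m, fold h (take m l) r0, list_encode l] (fold h (take (Suc m) l) r0)"
      by simp
  qed (auto intro: computes_const)
  have "computes (Comp ?g [Proj 0, Proj 0]) [list_encode l] (fold h l r0)" for l
    using g [of "list_encode l" l] length_le_list_encode [of l]
    by (auto intro!: computes_Comp2 computes_Proj)
  then show ?thesis by blast
qed

text \<open>Finitely many unrelated programs merge into one taking the index as input: recursion on
  the index splits off \<open>f 0\<close>, and the induction hypothesis handles the shifted
  family.\<close>

lemma computes_table:
  assumes "\<forall>k. \<exists>q. \<forall>r. computes q [r] (f k r)"
  shows "\<exists>s. \<forall>k r. computes s [k, r] (if k < N then f k r else r)"
  using assms
proof (induction N arbitrary: f)
  case 0
  show ?case by (rule exI [of _ "Proj 1"]) (auto intro: computes_Proj)
next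
  case (Suc N)
  obtain q where q: "\<And>r. computes q [r] (f 0 r)"
    using Suc.prems by blast
  obtain s where s: "\<And>k r. computes s [k, r] (if k < N then f (Suc k) r else r)"
    using Suc.IH [of "\<lambda>k. f (Suc k)"] Suc.prems by blast
  have "computes (Rec q (Comp s [Proj 0, Proj 2])) [k, r] (if k < Suc N then f k r else r)" for k r
  proof (rule computes_Rec [where F = "\<lambda>k. if k < Suc N then f k r else r"])
    show "computes (Comp s [Proj 0, Proj 2]) [m, if m < Suc N then f m r else r, r]
      (if Suc m < Suc N then f (Suc m) r else r)" for m
      using s [of m r] by (auto intro!: computes_Comp2 [OF computes_Proj computes_Proj] split: if_splits)
  qed (use q in simp)
  then show ?case by blast
qed

lemma computes_fold_append:
  "\<exists>q. \<forall>l. set l \<subseteq> {..<N} \<longrightarrow>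
    computes q [list_encode l] (list_encode (fold (\<lambda>k r. W k @ r) l r0))"
proof -
  \<comment> \<open>\<open>list_decode\<close> extends prepending \<open>W k\<close> to a function
    of all numbers.\<close>
  have "\<forall>k. \<exists>q. \<forall>r. computes q [r] (list_encode (W k @ list_decode r))"
    using computes_append by (metis list_decode_inverse)
  from computes_table [OF this] obtain s where
    "\<And>k r. computes s [k, r] (if k < N then list_encode (W k @ list_decode r) else r)"
    by blast
  from computes_fold [OF this] obtain q where q: "\<And>l. computes q [list_encode l]
    (fold (\<lambda>k r. if k < N then list_encode (W k @ list_decode r) else r) l (list_encode r0))"
    by blast
  have "computes q [list_encode l] (list_encode (fold (\<lambda>k r. W k @ r) l r0))"
    if "set l \<subseteq> {..<N}" for l
  proof -
    \<comment> \<open>Entries of \<open>l\<close> are below \<open>N\<close>, so the default of the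
      table is never reached.\<close>
    have "fold (\<lambda>k r. if k < N then list_encode (W k @ list_decode r) else r) l (list_encode r0)
        = list_encode (fold (\<lambda>k r. W k @ r) l r0)"
      using that by (induction l arbitrary: r0) simp_all
    with q [of l] show ?thesis by simp
  qed
  then show ?thesis by blast
qed

section \<open>Words\<close>

definition letter_code :: "('a \<Rightarrow> nat) \<Rightarrow> 'a \<times> bool \<Rightarrow> nat" where
  "letter_code c = (\<lambda>(z, e). 2 * c z + of_bool e)"

lemma word_code_letter_code: "word_code c w = list_encode (map (letter_code c) w)"
  by (simp add: word_code_def letter_code_def)

text \<open>Halving a code recovers the generator's number, its parity the sign.\<close>

lemma inj_on_letter_code: "inj_on c Z \<Longrightarrow> inj_on (letter_code c) (Z \<times> UNIV)"
proof (rule inj_onI)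
  fix x y assume inj: "inj_on c Z" and xy: "x \<in> Z \<times> UNIV" "y \<in> Z \<times> UNIV"
    and eq: "letter_code c x = letter_code c y"
  have "letter_code c x div 2 = c (fst x)" "odd (letter_code c x) = snd x" for x
    by (auto simp: letter_code_def split: prod.split)
  with eq have "c (fst x) = c (fst y)" "snd x = snd y" by metis+
  with inj xy show "x = y" by (auto dest: inj_onD)
qed

lemma letter_code_less: "c z < n \<Longrightarrow> letter_code c (z, e) < 2 * n"
  by (simp add: letter_code_def)

text \<open>The alphabet is finite, so the replacement words \<open>W x\<close>, however chosen, fit
  into a finite table inside the program.\<close>

lemma computes_word_substitution:
  assumes "inj_on d Y" "d ` Y \<subseteq> {..<n}"
  shows "\<exists>q. \<forall>u\<in>group_words Y.
    computes q [word_code d u] (word_code c (fold (\<lambda>x r. W x @ r) u w0))"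
proof -
  let ?V = "\<lambda>k. map (letter_code c) (W (inv_into (Y \<times> UNIV) (letter_code d) k))"
  obtain q where q: "\<And>l. set l \<subseteq> {..<2 * n} \<Longrightarrow> computes q [list_encode l]
      (list_encode (fold (\<lambda>k r. ?V k @ r) l (map (letter_code c) w0)))"
    using computes_fold_append [of "2 * n" ?V "map (letter_code c) w0"] by blast
  have "computes q [word_code d u] (word_code c (fold (\<lambda>x r. W x @ r) u w0))"
    if u: "u \<in> group_words Y" for u
  proof -
    have "fold (\<lambda>k r. ?V k @ r) (map (letter_code d) u) (map (letter_code c) w)
        = map (letter_code c) (fold (\<lambda>x r. W x @ r) u w)" for w
      using u
    proof (induction u arbitrary: w)
      case (Cons x u)
      then have "x \<in> Y \<times> UNIV" "u \<in> group_words Y"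
        by (simp_all add: group_words_def)
      then show ?case
        using Cons.IH [of "W x @ w"] by (simp add: inv_into_f_f [OF inj_on_letter_code [OF assms(1)]])
    qed simp
    moreover have "set (map (letter_code d) u) \<subseteq> {..<2 * n}"
      using u assms(2) by (auto simp: group_words_def intro!: letter_code_less)
    ultimately show ?thesis
      using q [of "map (letter_code d) u"] by (simp add: word_code_letter_code)
  qed
  then show ?thesis by blast
qed

section \<open>Evaluating words; conjugacy and inverses\<close>

context group
begin

lemma word_eval_closed: "Z \<subseteq> carrier G \<Longrightarrow> w \<in> group_words Z \<Longrightarrow> word_eval G w \<in> carrier G"
  by (induction w) (auto simp: group_words_def)

lemma word_eval_append:
  assumes "Z \<subseteq> carrier G" "v \<in> group_words Z" "w \<in> group_words Z"
  shows "word_eval G (v @ w) = word_eval G v \<otimes> word_eval G w"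
  using assms(2)
proof (induction v)
  case Nil
  then show ?case using word_eval_closed assms by simp
next
  case (Cons x v)
  then have "v \<in> group_words Z" "fst x \<in> carrier G"
    using assms(1) by (auto simp: group_words_def)
  with Cons.IH show ?case
    using word_eval_closed [OF assms(1)] assms(3) by (cases x) (auto simp: m_assoc)
qed

lemma generate_word:
  assumes "Z \<subseteq> carrier G" "x \<in> generate G Z"
  shows "\<exists>w\<in>group_words Z. word_eval G w = x"
  using assms(2)
proof induction
  case one
  show ?case by (rule bexI [of _ "[]"]) (auto simp: group_words_def)
next
  case (incl z)
  then show ?case using assms(1) by (intro bexI [of _ "[(z, True)]"]) (auto simp: group_words_def)
next
  case (inv z)
  then show ?case using assms(1) by (intro bexI [of _ "[(z, False)]"]) (auto simp: group_words_def)
next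
  case (eng x y)
  then obtain v w where vw: "v \<in> group_words Z" "w \<in> group_words Z"
      "word_eval G v = x" "word_eval G w = y"
    by blast
  then show ?case
    using word_eval_append [OF assms(1)]
    by (intro bexI [of _ "v @ w"]) (auto simp: group_words_def)
qed

text \<open>Free of inverses, so that conjugacy in the extension can be read off from its
  multiplication alone.\<close>

lemma conjugate_in_iff:
  assumes "x \<in> carrier G" "y \<in> carrier G"
  shows "conjugate_in G x y \<longleftrightarrow> (\<exists>g\<in>carrier G. g \<otimes> x = y \<otimes> g)"
  unfolding conjugate_in_def using assms by (metis inv_solve_right m_closed)

lemma conjugate_in_inv:
  assumes "x \<in> carrier G" "y \<in> carrier G"
  shows "conjugate_in G (inv x) (inv y) \<longleftrightarrow> conjugate_in G x y"
proof -
  have "g \<otimes> inv x = inv y \<otimes> g \<longleftrightarrow> g \<otimes> x = y \<otimes> g" if "g \<in> carrier G" for g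
    using assms that
    by (metis inv_closed inv_solve_left inv_solve_right m_assoc m_closed)
  then show ?thesis using assms by (simp add: conjugate_in_iff)
qed

lemma word_eval_subgroup:
  assumes "subgroup H G" "w \<in> group_words H"
  shows "word_eval (G\<lparr>carrier := H\<rparr>) w = word_eval G w"
  using assms(2)
  by (induction w)
    (auto simp: group_words_def m_inv_consistent [OF assms(1)])

end

section \<open>The semidirect product\<close>

locale index_two_subgroup = group G for G :: "('a, 'b) monoid_scheme" (structure) +
  fixes H :: "'a set"
  assumes subgroup: "subgroup H G" and index: "card (rcosets H) = 2"
begin

text \<open>Membership in \<open>H\<close> is a homomorphism onto a group of order 2. The index
  enters when \<open>x\<close> and \<open>y\<close> both lie outside \<open>H\<close>: the cosets of
  \<open>x\<close> and \<open>inv y\<close> are then both the one other than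
  \<open>H\<close>.\<close>

lemma mult_mem_iff:
  assumes "x \<in> carrier G" "y \<in> carrier G"
  shows "x \<otimes> y \<in> H \<longleftrightarrow> (x \<in> H \<longleftrightarrow> y \<in> H)"
proof -
  interpret subgroup H G by (rule subgroup)
  have *: "x \<otimes> y \<in> H" if "x \<notin> H" "y \<notin> H"
  proof -
    have inv: "inv y \<in> carrier G" "inv y \<notin> H"
      using that assms m_inv_closed by fastforce+
    obtain C D where CD: "rcosets H = {C, D}"
      using index by (metis card_2_iff)
    have ne: "H #> z \<noteq> H" if "z \<in> carrier G" "z \<notin> H" for z
      using that rcos_self [OF _ subgroup] by blast
    have mem: "H \<in> {C, D}" "H #> x \<in> {C, D}" "H #> inv y \<in> {C, D}"
      using CD subgroup_in_rcosets [OF is_group] rcosetsI [OF subset] assms inv by auto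
    have "H #> x = H #> inv y"
      using mem ne [OF assms(1) that(1)] ne [OF inv] by auto
    then have "x \<in> H #> inv y" using rcos_self [OF assms(1) subgroup] by simp
    then obtain h where "h \<in> H" "x = h \<otimes> inv y" by (auto simp: r_coset_def)
    then show ?thesis using assms by (simp add: m_assoc)
  qed
  have "y \<in> H" if "x \<in> H" "x \<otimes> y \<in> H"
    using m_closed [OF m_inv_closed [OF that(1)] that(2)] assms by (simp add: m_assoc [symmetric])
  moreover have "x \<in> H" if "y \<in> H" "x \<otimes> y \<in> H"
    using m_closed [OF that(2) m_inv_closed [OF that(1)]] assms by (simp add: m_assoc)
  ultimately show ?thesis using * m_closed by blast
qed

text \<open>The exponent \<open>2\<close> is \<open>-1\<close> modulo 3.\<close>

definition act :: "'a \<Rightarrow> nat" where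
  "act g = (if g \<in> H then 1 else 2)"

text \<open>The pair \<open>(g, i)\<close> stands for \<open>g c\<^sup>i\<close>, where \<open>g\<^sup>-\<^sup>1 c g = c\<close> raised to the power \<open>act g\<close>.\<close>

definition extension :: "('a \<times> nat) monoid" where
  "extension = \<lparr>carrier = carrier G \<times> {..<3},
    monoid.mult = (\<lambda>(g, i) (g', j). (g \<otimes> g', (act g' * i + j) mod 3)), one = (\<one>, 0)\<rparr>"

lemma extension_simps [simp]:
  "carrier extension = carrier G \<times> {..<3}"
  "(g, i) \<otimes>\<^bsub>extension\<^esub> (g', j) = (g \<otimes> g', (act g' * i + j) mod 3)"
  "\<one>\<^bsub>extension\<^esub> = (\<one>, 0)"
  by (simp_all add: extension_def)

lemma act_one: "act \<one> = 1"
  using subgroup.one_closed [OF subgroup] by (simp add: act_def)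

text \<open>The congruence is essential: for two elements outside \<open>H\<close> the right side
  involves 4, the left 1.\<close>

lemma act_mult:
  "x \<in> carrier G \<Longrightarrow> y \<in> carrier G \<Longrightarrow> act (x \<otimes> y) mod 3 = act x * act y mod 3"
  by (auto simp: act_def mult_mem_iff)

lemma inv_mem_iff: "x \<in> carrier G \<Longrightarrow> inv x \<in> H \<longleftrightarrow> x \<in> H"
  using mult_mem_iff [of x "inv x"] subgroup.one_closed [OF subgroup] by simp

lemma group_extension: "group extension"
proof (rule groupI)
  fix x y z assume "x \<in> carrier extension" "y \<in> carrier extension" "z \<in> carrier extension"
  then obtain g i g' j g'' k where *: "x = (g, i)" "y = (g', j)" "z = (g'', k)"
    "g \<in> carrier G" "g' \<in> carrier G" "g'' \<in> carrier G"
    by auto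
  have "(act g'' * ((act g' * i + j) mod 3) + k) mod 3 = (act g'' * (act g' * i + j) + k) mod 3"
    by (metis mod_add_left_eq mod_mult_right_eq)
  also have "\<dots> = (act g' * act g'' * i + (act g'' * j + k)) mod 3"
    by (simp add: algebra_simps)
  also have "\<dots> = (act (g' \<otimes> g'') * i + (act g'' * j + k)) mod 3"
    using act_mult [of g' g''] * by (metis mod_add_left_eq mod_mult_left_eq)
  also have "\<dots> = (act (g' \<otimes> g'') * i + (act g'' * j + k) mod 3) mod 3"
    by (simp add: mod_simps)
  finally show "x \<otimes>\<^bsub>extension\<^esub> y \<otimes>\<^bsub>extension\<^esub> z = x \<otimes>\<^bsub>extension\<^esub> (y \<otimes>\<^bsub>extension\<^esub> z)"
    using * by (simp add: m_assoc)
next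
  fix x assume "x \<in> carrier extension"
  then obtain g i where x: "x = (g, i)" "g \<in> carrier G" "i < 3" by auto
  \<comment> \<open>The first component of the inverse acts as \<open>g\<close> does. This exponent
    works because \<open>2 * (act g)^2 + 1\<close> is 3 or 9, a multiple of 3.\<close>
  let ?j = "2 * act g * i mod 3"
  have "(act g * ?j + i) mod 3 = (act g * (2 * act g * i) + i) mod 3"
    by (metis mod_add_left_eq mod_mult_right_eq)
  also have "\<dots> = 0" by (cases "g \<in> H") (simp_all add: act_def)
  finally show "\<exists>y\<in>carrier extension. y \<otimes>\<^bsub>extension\<^esub> x = \<one>\<^bsub>extension\<^esub>"
    using x by (intro bexI [of _ "(inv g, (2 * act (inv g) * i) mod 3)"])
      (auto simp: act_def inv_mem_iff)
qed (auto simp: act_one)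

section \<open>Embedding, index and generators of the extension\<close>

lemma mon_extension: "(\<lambda>g. (g, 0)) \<in> mon G extension"
  by (auto simp: mon_def hom_def inj_on_def)

text \<open>The product of \<open>(x, 0)\<close> and \<open>(g, i)\<close> is
  \<open>(x g, i)\<close>, so the right cosets are the fibres of the second component.\<close>

lemma index_extension: "card (rcosets\<^bsub>extension\<^esub> ((\<lambda>g. (g, 0)) ` carrier G)) = 3"
proof -
  interpret K: group extension by (rule group_extension)
  have coset: "((\<lambda>g. (g, 0)) ` carrier G) #>\<^bsub>extension\<^esub> (g, i) = carrier G \<times> {i}"
    if "g \<in> carrier G" "i < 3" for g i
  proof -
    have "((\<lambda>g. (g, 0)) ` carrier G) #>\<^bsub>extension\<^esub> (g, i) = (\<lambda>x. (x \<otimes> g, i)) ` carrier G"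
      using that by (auto simp: r_coset_def)
    also have "\<dots> = (\<lambda>x. x \<otimes> g) ` carrier G \<times> {i}" by auto
    also have "(\<lambda>x. x \<otimes> g) ` carrier G = carrier G"
      using coset_join2 [OF that(1) subgroup_self that(1)]
      by (simp add: r_coset_def UNION_singleton_eq_range)
    finally show ?thesis .
  qed
  have "rcosets\<^bsub>extension\<^esub> ((\<lambda>g. (g, 0)) ` carrier G)
      = (\<lambda>i. carrier G \<times> {i}) ` snd ` carrier extension"
    unfolding RCOSETS_def UNION_singleton_eq_range image_image
    by (intro image_cong refl) (auto simp only: extension_simps coset mem_Times_iff lessThan_iff
        split_paired_all fst_conv snd_conv)
  also have "snd ` carrier extension = {..<3}"
    using one_closed by (auto simp: image_iff)
  finally have "rcosets\<^bsub>extension\<^esub> ((\<lambda>g. (g, 0)) ` carrier G) = (\<lambda>i. carrier G \<times> {i}) ` {..<3}" .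
  moreover have "inj_on (\<lambda>i::nat. carrier G \<times> {i}) {..<3}"
    \<comment> \<open>A nonempty carrier keeps the three fibres distinct.\<close>
    using one_closed by (auto simp: inj_on_def)
  ultimately show ?thesis by (simp add: card_image)
qed

text \<open>Embedded generators of \<open>G\<close> together with \<open>c = (\<one>, 1)\<close>
  suffice: right multiplication by \<open>c\<close> raises the second component by one.\<close>

lemma finitely_generated_extension:
  assumes "finitely_generated G"
  shows "finitely_generated extension"
proof -
  interpret K: group extension by (rule group_extension)
  obtain S where S: "finite S" "S \<subseteq> carrier G" "generate G S = carrier G"
    using assms by (auto simp: finitely_generated_def generating_set_def)
  let ?Z = "insert (\<one>, 1) ((\<lambda>g. (g, 0)) ` S)"
  have Z: "?Z \<subseteq> carrier extension" using S by auto
  have base: "(g, 0) \<in> generate extension ?Z" if "g \<in> carrier G" for g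
  proof -
    have "(\<lambda>g. (g, 0)) ` generate G S = generate extension ((\<lambda>g. (g, 0)) ` S)"
      using mon_extension S(2)
      by (intro group_hom.generate_img [symmetric] group_hom.intro [OF is_group group_extension])
        (auto simp: group_hom_axioms_def mon_def)
    then have "(g, 0) \<in> generate extension ((\<lambda>g. (g, 0)) ` S)"
      using S(3) that by auto
    then show ?thesis
      using K.mono_generate [of "(\<lambda>g. (g, 0)) ` S" ?Z] by blast
  qed
  have c1: "(\<one>, 1) \<in> generate extension ?Z" by (rule generate.incl) simp
  have "(g, i) \<in> generate extension ?Z" if g: "g \<in> carrier G" and "i < 3" for g i
    using that(2)
  proof (induction i)
    case (Suc i)
    then have "(g, i) \<otimes>\<^bsub>extension\<^esub> (\<one>, 1) \<in> generate extension ?Z"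
      using generate.eng c1 by fastforce
    then show ?case using Suc.prems g by (simp add: act_one)
  qed (rule base [OF g])
  then have gen: "generate extension ?Z = carrier extension"
    using K.generate_incl [OF Z] by auto
  show ?thesis
    unfolding finitely_generated_def generating_set_def
    by (intro exI [of _ ?Z] conjI Z gen) (use S(1) in simp)
qed

section \<open>Conjugacy in the extension and the reduction\<close>

lemma conjugate_extension_iff:
  assumes "h \<in> H" "h' \<in> H"
  shows "conjugate_in extension (h, 1) (h', 1) \<longleftrightarrow> conjugate_in (G\<lparr>carrier := H\<rparr>) h h'"
proof -
  interpret K: group extension by (rule group_extension)
  interpret H: group "G\<lparr>carrier := H\<rparr>" by (rule subgroup_imp_group [OF subgroup])
  have h: "h \<in> carrier G" "h' \<in> carrier G" using assms subgroup.mem_carrier [OF subgroup] by auto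
  \<comment> \<open>The two sides are \<open>(g, i) (h, 1)\<close> and
    \<open>(h', 1) (g, i)\<close>; on the left, \<open>act h = 1\<close> since \<open>h\<close> lies
    in \<open>H\<close>.\<close>
  have "conjugate_in extension (h, 1) (h', 1) \<longleftrightarrow>
      (\<exists>g\<in>carrier G. \<exists>i<3. g \<otimes> h = h' \<otimes> g \<and> (i + 1) mod 3 = (act g + i) mod 3)"
    using h assms by (subst K.conjugate_in_iff) (auto simp: act_def)
  also have "\<dots> \<longleftrightarrow> (\<exists>g\<in>carrier G. g \<in> H \<and> g \<otimes> h = h' \<otimes> g)"
  proof -
    \<comment> \<open>Cancelling \<open>i\<close> leaves \<open>act g\<close> congruent to 1, which
      excludes the value 2; conversely \<open>i = 0\<close> is a witness.\<close>
    have "(\<exists>i<3. (i + 1) mod 3 = (act g + i) mod 3) \<longleftrightarrow> g \<in> H" for g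
      by (auto simp: act_def mod_Suc split: if_splits intro: exI [of _ 0])
    then show ?thesis by blast
  qed
  also have "\<dots> \<longleftrightarrow> conjugate_in (G\<lparr>carrier := H\<rparr>) h h'"
    using assms subgroup.mem_carrier [OF subgroup] by (subst H.conjugate_in_iff) auto
  finally show ?thesis .
qed

text \<open>A many-one reduction: one program translates each word over \<open>Y\<close> to a word
  over \<open>Z\<close>, and the given algorithm is run on the two translations.\<close>

lemma solvable_extension_imp_solvable:
  assumes Z: "generating_set extension Z" and "conjugacy_problem_solvable extension Z"
    and "finite Y" "Y \<subseteq> H"
  shows "conjugacy_problem_solvable (G\<lparr>carrier := H\<rparr>) Y"
proof -
  interpret K: group extension by (rule group_extension)
  interpret H: group "G\<lparr>carrier := H\<rparr>" by (rule subgroup_imp_group [OF subgroup])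
  have HG: "h \<in> carrier G" if "h \<in> H" for h
    using that subgroup.mem_carrier [OF subgroup] by blast
  have ZK: "Z \<subseteq> carrier extension" and gen: "generate extension Z = carrier extension"
    using Z by (auto simp: generating_set_def)
  obtain c p where p: "\<And>u v. u \<in> group_words Z \<Longrightarrow> v \<in> group_words Z \<Longrightarrow>
      computes p [word_code c u, word_code c v]
        (if conjugate_in extension (word_eval extension u) (word_eval extension v) then 1 else 0)"
    using assms(2) unfolding conjugacy_problem_solvable_def by blast
  obtain d where d: "bij_betw d Y {..<card Y}"
    using ex_bij_betw_finite_nat [OF \<open>finite Y\<close>] by (auto simp: atLeast0LessThan)
  have word: "\<exists>w\<in>group_words Z. word_eval extension w = x" if "x \<in> carrier extension" for x
    using K.generate_word [OF ZK] gen that by simp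
  obtain w0 where w0: "w0 \<in> group_words Z" "word_eval extension w0 = (\<one>, 1)"
    using word [of "(\<one>, 1)"] by auto
  \<comment> \<open>The words for the inverted letters are merely chosen; they need not be found
    effectively, as only finitely many enter the program.\<close>
  have "\<forall>x\<in>Y \<times> (UNIV::bool set). \<exists>w\<in>group_words Z.
      word_eval extension w = (inv word_eval G [x], 0)"
    using \<open>Y \<subseteq> H\<close> HG by (intro ballI word) auto
  then obtain W where W: "\<And>x. x \<in> Y \<times> (UNIV::bool set) \<Longrightarrow> W x \<in> group_words Z"
    "\<And>x. x \<in> Y \<times> (UNIV::bool set) \<Longrightarrow> word_eval extension (W x) = (inv word_eval G [x], 0)"
    by metis
  let ?T = "\<lambda>u. fold (\<lambda>x r. W x @ r) u w0"
  have words_H: "u \<in> group_words H" if "u \<in> group_words Y" for u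
    using that \<open>Y \<subseteq> H\<close> by (auto simp: group_words_def)
  have eval_H: "word_eval G u \<in> H" if "u \<in> group_words Y" for u
    using H.word_eval_closed [of H u] words_H [OF that] word_eval_subgroup [OF subgroup] by simp
  text \<open>A left fold pushes the letters in reverse order; as each is replaced by its inverse, the
    result represents the inverse of the given word.\<close>
  have T: "?T u \<in> group_words Z \<and> word_eval extension (?T u) = (inv word_eval G u, 1)"
    if "u \<in> group_words Y" for u
    using that
  proof (induction u rule: rev_induct)
    case Nil
    then show ?case using w0 by simp
  next
    case (snoc x u)
    then have u: "u \<in> group_words Y" and x: "x \<in> Y \<times> UNIV"
      by (auto simp: group_words_def)
    have x': "[x] \<in> group_words Y" using x by (simp add: group_words_def)
    have YG: "Y \<subseteq> carrier G" using \<open>Y \<subseteq> H\<close> HG by blast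
    have Tu: "?T u \<in> group_words Z" "word_eval extension (?T u) = (inv word_eval G u, 1)"
      using snoc.IH [OF u] by auto
    have "word_eval extension (?T (u @ [x]))
        = (inv word_eval G [x], 0) \<otimes>\<^bsub>extension\<^esub> (inv word_eval G u, 1)"
      using K.word_eval_append [OF ZK W(1) [OF x] Tu(1)] W(2) [OF x] Tu(2) by simp
    also have "\<dots> = (inv word_eval G (u @ [x]), 1)"
      using word_eval_append [OF YG u x'] word_eval_closed [OF YG u] word_eval_closed [OF YG x']
      by (simp add: inv_mult_group)
    finally show ?case
      using W(1) [OF x] Tu(1) by (auto simp: group_words_def)
  qed
  obtain q where q: "\<And>u. u \<in> group_words Y \<Longrightarrow> computes q [word_code d u] (word_code c (?T u))"
    using computes_word_substitution [of d Y "card Y" c W w0] d by (auto simp: bij_betw_def)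
  have "computes (Comp p [Comp q [Proj 0], Comp q [Proj 1]]) [word_code d u, word_code d v]
      (if conjugate_in (G\<lparr>carrier := H\<rparr>) (word_eval (G\<lparr>carrier := H\<rparr>) u)
        (word_eval (G\<lparr>carrier := H\<rparr>) v) then 1 else 0)"
    if u: "u \<in> group_words Y" and v: "v \<in> group_words Y" for u v
  proof -
    have "conjugate_in extension (word_eval extension (?T u)) (word_eval extension (?T v))
        \<longleftrightarrow> conjugate_in (G\<lparr>carrier := H\<rparr>) (inv word_eval G u) (inv word_eval G v)"
      using T [OF u] T [OF v] eval_H [OF u] eval_H [OF v]
      by (simp only: conjugate_extension_iff inv_mem_iff HG)
    \<comment> \<open>Inverting both elements preserves conjugacy, which undoes the inversion caused
      by the translation.\<close>
    also have "\<dots> \<longleftrightarrow> conjugate_in (G\<lparr>carrier := H\<rparr>) (word_eval G u) (word_eval G v)"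
      using H.conjugate_in_inv [of "word_eval G u" "word_eval G v"] eval_H [OF u] eval_H [OF v]
      by (simp add: m_inv_consistent [OF subgroup])
    finally have conj: "conjugate_in extension (word_eval extension (?T u)) (word_eval extension (?T v))
        \<longleftrightarrow> conjugate_in (G\<lparr>carrier := H\<rparr>) (word_eval (G\<lparr>carrier := H\<rparr>) u)
          (word_eval (G\<lparr>carrier := H\<rparr>) v)"
      using word_eval_subgroup [OF subgroup] words_H u v by simp
    have q0: "computes (Comp q [Proj 0]) [word_code d u, word_code d v] (word_code c (?T u))"
      and q1: "computes (Comp q [Proj 1]) [word_code d u, word_code d v] (word_code c (?T v))"
      using q u v by (auto intro!: computes_Comp1 [OF computes_Proj])
    show ?thesis
      using computes_Comp2 [OF q0 q1 p] T [OF u] T [OF v] conj by simp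
  qed
  with d show ?thesis
    unfolding conjugacy_problem_solvable_def by blast
qed

end

theorem corollary6p2:
  fixes G :: "('a, 'b) monoid_scheme" and H :: "'a set"
  assumes "group G"
    and "finitely_generated G"
    and "subgroup H G"
    and "card (rcosets\<^bsub>G\<^esub> H) = 2"
    and "\<exists>Y. finite Y \<and> generating_set (G\<lparr>carrier := H\<rparr>) Y \<and>
           \<not> conjugacy_problem_solvable (G\<lparr>carrier := H\<rparr>) Y"
  shows "\<exists>(K :: ('a \<times> nat) monoid) \<iota>.
           group K \<and> \<iota> \<in> mon G K \<and> card (rcosets\<^bsub>K\<^esub> (\<iota> ` carrier G)) = 3 \<and>
           finitely_generated K \<and>
           (\<forall>Z. finite Z \<and> generating_set K Z \<longrightarrow> \<not> conjugacy_problem_solvable K Z)"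
proof -
  interpret index_two_subgroup G H
    using assms by (intro index_two_subgroup.intro index_two_subgroup_axioms.intro)
  obtain Y where "finite Y" "generating_set (G\<lparr>carrier := H\<rparr>) Y"
    "\<not> conjugacy_problem_solvable (G\<lparr>carrier := H\<rparr>) Y"
    using assms(5) by blast
  \<comment> \<open>As \<open>Z\<close> is arbitrary in the reduction, a single bad \<open>Y\<close>
    for \<open>H\<close> rules out every generating set of the extension.\<close>
  then have "\<not> conjugacy_problem_solvable extension Z" if "generating_set extension Z" for Z
    using solvable_extension_imp_solvable [OF that] by (auto simp: generating_set_def)
  then show ?thesis
    using group_extension mon_extension index_extension finitely_generated_extension [OF assms(2)]
    by blast
qed

end
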